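(* Let $0\le k\le n$. For every $f\in\operatorname{Bound}(k,n)$, the bounded affine Lascoux–Schützenberger tree of $f$ is finite.
   Context: Affine permutations $\widetilde S_n$: bijections $f:\mathbb{Z}\to\mathbb{Z}$ with $f(i+n)=f(i)+n$. $\ell(f)=\#\{(i,j):1\le i\le n,\ i<j,\ f(i)>f(j)\}$. For $i<j$, $i\not\equiv j\pmod n$, $t_{ij}$ swaps $i+pn$ and $j+pn$ for all $p\in\mathbb{Z}$. Bruhat cover: $f\lessdot ft_{ij}$ iff $\ell(ft_{ij})=\ell(f)+1$. $\operatorname{Bound}(k,n)$ is the set of $f$ with $i\le f(i)\le i+n$ for all $i$ and exactly $k$ of $f(1),\dots,f(n)$ exceeding $n$. For $r\in\mathbb{Z}$: $\Phi^+(f,r)=\{ft_{rj}: r<j,\ f\lessdot ft_{rj}\}$, $\Phi^-(f,r)=\{ft_{ir}: i<r,\ f\lessdot ft_{ir}\}$, $B\Phi^\pm(f,r)=\Phi^\pm(f,r)\cap\operatorname{Bound}(k,n)$. The maximal inversion of $g\in\operatorname{Bound}(k,n)$ is the lexicographically largest $(r,s)$ with $1\le r<s\le n$, $g(r)>g(s)$; if there is none, $g$ is $0$-Grassmannian. The bounded affine L-S tree of $f$ is the rooted tree with vertices labeled by elements of $\operatorname{Bound}(k,n)$: the root is $f$; a $0$-Grassmannian vertex $g$ has no children; otherwise, with $(r,s)$ the maximal inversion of $g$, the children of $g$ are the elements of $B\Phi^-(gt_{rs},r)$ and of $B\Phi^+(gt_{rs},r)\setminus\{g\}$. *)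

theory Defs
  imports "HOL-Number_Theory.Cong"
begin

definition affine_perms :: "nat \<Rightarrow> (int \<Rightarrow> int) set" where
  "affine_perms n = {f. bij f \<and> (\<forall>i. f (i + int n) = f i + int n)}"

definition aff_length :: "nat \<Rightarrow> (int \<Rightarrow> int) \<Rightarrow> nat" where
  "aff_length n f = card {(i, j). 1 \<le> i \<and> i \<le> int n \<and> i < j \<and> f i > f j}"

text \<open>Only meaningful for \<open>i\<close> and \<open>j\<close> incongruent modulo \<open>n\<close>.\<close>

definition aff_transp :: "nat \<Rightarrow> int \<Rightarrow> int \<Rightarrow> int \<Rightarrow> int" where
  "aff_transp n i j x =
     (if [x = i] (mod int n) then x - i + j
      else if [x = j] (mod int n) then x - j + i
      else x)"

definition bruhat_cover :: "nat \<Rightarrow> (int \<Rightarrow> int) \<Rightarrow> (int \<Rightarrow> int) \<Rightarrow> bool" where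
  "bruhat_cover n f g \<longleftrightarrow>
     (\<exists>i j. i < j \<and> \<not> [i = j] (mod int n) \<and> g = f \<circ> aff_transp n i j)
     \<and> aff_length n g = aff_length n f + 1"

definition Bound :: "nat \<Rightarrow> nat \<Rightarrow> (int \<Rightarrow> int) set" where
  "Bound k n = {f \<in> affine_perms n. (\<forall>i. i \<le> f i \<and> f i \<le> i + int n)
     \<and> card {i \<in> {1..int n}. f i > int n} = k}"

definition Phi_plus :: "nat \<Rightarrow> (int \<Rightarrow> int) \<Rightarrow> int \<Rightarrow> (int \<Rightarrow> int) set" where
  "Phi_plus n f r = {f \<circ> aff_transp n r j | j.
     r < j \<and> \<not> [r = j] (mod int n) \<and> bruhat_cover n f (f \<circ> aff_transp n r j)}"

definition Phi_minus :: "nat \<Rightarrow> (int \<Rightarrow> int) \<Rightarrow> int \<Rightarrow> (int \<Rightarrow> int) set" where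
  "Phi_minus n f r = {f \<circ> aff_transp n i r | i.
     i < r \<and> \<not> [i = r] (mod int n) \<and> bruhat_cover n f (f \<circ> aff_transp n i r)}"

definition BPhi_plus :: "nat \<Rightarrow> nat \<Rightarrow> (int \<Rightarrow> int) \<Rightarrow> int \<Rightarrow> (int \<Rightarrow> int) set" where
  "BPhi_plus k n f r = Phi_plus n f r \<inter> Bound k n"

definition BPhi_minus :: "nat \<Rightarrow> nat \<Rightarrow> (int \<Rightarrow> int) \<Rightarrow> int \<Rightarrow> (int \<Rightarrow> int) set" where
  "BPhi_minus k n f r = Phi_minus n f r \<inter> Bound k n"

definition window_inversions :: "nat \<Rightarrow> (int \<Rightarrow> int) \<Rightarrow> (int \<times> int) set" where
  "window_inversions n g = {(r, s). 1 \<le> r \<and> r < s \<and> s \<le> int n \<and> g r > g s}"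

definition zero_grassmannian :: "nat \<Rightarrow> (int \<Rightarrow> int) \<Rightarrow> bool" where
  "zero_grassmannian n g \<longleftrightarrow> window_inversions n g = {}"

definition maximal_inversion :: "nat \<Rightarrow> (int \<Rightarrow> int) \<Rightarrow> int \<Rightarrow> int \<Rightarrow> bool" where
  "maximal_inversion n g r s \<longleftrightarrow> (r, s) \<in> window_inversions n g
     \<and> (\<forall>(r', s') \<in> window_inversions n g. r' < r \<or> (r' = r \<and> s' \<le> s))"

lemma maximal_inversion_unique:
  assumes "maximal_inversion n g r s" and "maximal_inversion n g r' s'"
  shows "r = r' \<and> s = s'"
proof -
  have "r' < r \<or> (r' = r \<and> s' \<le> s)" "r < r' \<or> (r = r' \<and> s \<le> s')"
    using assms by (auto simp: maximal_inversion_def)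
  then show ?thesis by linarith
qed

lemma maximal_inversion_exists:
  assumes "\<not> zero_grassmannian n g"
  shows "\<exists>r s. maximal_inversion n g r s"
proof -
  let ?W = "window_inversions n g"
  have ne: "?W \<noteq> {}"
    using assms by (simp add: zero_grassmannian_def)
  have "?W \<subseteq> {1..int n} \<times> {1..int n}"
    by (auto simp: window_inversions_def)
  then have fin: "finite ?W"
    by (rule finite_subset) simp
  define r where "r = Max (fst ` ?W)"
  have r: "r \<in> fst ` ?W" "\<forall>x \<in> ?W. fst x \<le> r"
    using fin ne by (auto simp: r_def)
  define S where "S = {s. (r, s) \<in> ?W}"
  have S: "finite S" "S \<noteq> {}"
  proof -
    have "S \<subseteq> snd ` ?W"
      unfolding S_def using image_eqI[of _ snd] by fastforce
    then show "finite S"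
      using fin finite_surj by blast
    show "S \<noteq> {}"
      using r(1) by (auto simp: S_def)
  qed
  have "(r, Max S) \<in> ?W"
    using Max_in[OF S] by (simp add: S_def)
  moreover have "r' < r \<or> (r' = r \<and> s' \<le> Max S)" if "(r', s') \<in> ?W" for r' s'
  proof (cases "r' = r")
    case True
    then show ?thesis
      using that S(1) by (simp add: S_def)
  next
    case False
    have "r' \<le> r"
      using bspec[OF r(2) that] by simp
    with False show ?thesis by simp
  qed
  ultimately have "maximal_inversion n g r (Max S)"
    by (auto simp: maximal_inversion_def)
  then show ?thesis by blast
qed

definition ls_children :: "nat \<Rightarrow> nat \<Rightarrow> (int \<Rightarrow> int) \<Rightarrow> (int \<Rightarrow> int) set" where
  "ls_children k n g = {h. \<not> zero_grassmannian n g \<and> (\<exists>r s. maximal_inversion n g r s \<and>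
     h \<in> BPhi_minus k n (g \<circ> aff_transp n r s) r
        \<union> (BPhi_plus k n (g \<circ> aff_transp n r s) r - {g}))}"

text \<open>The two sets of children are disjoint, so that no child is lost by taking their union.\<close>

lemma BPhi_disjoint:
  assumes "inj f"
  shows "BPhi_minus k n f r \<inter> BPhi_plus k n f r = {}"
proof -
  have ne: "f \<circ> aff_transp n i r \<noteq> f \<circ> aff_transp n r j"
    if "i < r" "r < j" "\<not> [i = r] (mod int n)" for i j
  proof
    assume "f \<circ> aff_transp n i r = f \<circ> aff_transp n r j"
    then have "f (aff_transp n i r r) = f (aff_transp n r j r)"
      by (metis comp_apply)
    then have "aff_transp n i r r = aff_transp n r j r"
      using assms by (simp only: inj_eq)
    moreover have "\<not> [r = i] (mod int n)"
      using that(3) cong_sym by blast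
    ultimately show False
      using that(1,2) by (simp add: aff_transp_def)
  qed
  then show ?thesis
    unfolding BPhi_minus_def BPhi_plus_def Phi_minus_def Phi_plus_def by blast
qed

text \<open>The same label may occur at several vertices of the tree. A vertex is therefore represented
  by the list of labels along the path from the root to it: its label is the last element of the
  list, and its parent is the list without the last element.\<close>

inductive_set ls_tree :: "nat \<Rightarrow> nat \<Rightarrow> (int \<Rightarrow> int) \<Rightarrow> (int \<Rightarrow> int) list set"
  for k n :: nat and f :: "int \<Rightarrow> int" where
  root: "[f] \<in> ls_tree k n f"
| child: "p \<in> ls_tree k n f \<Longrightarrow> h \<in> ls_children k n (last p) \<Longrightarrow> p @ [h] \<in> ls_tree k n f"

end

theory Submission
  imports Defs "HOL-Library.FuncSet"
begin

text \<open>Let \<open>(r, s)\<close> be the maximal inversion of \<open>g\<close> and let \<open>h\<close> be a child of \<open>g\<close>. Passing from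
  \<open>g\<close> to \<open>h\<close> increases the value at \<open>s\<close> and decreases no value at a position in \<open>{r<..n}\<close>:
  this uses that a Bruhat cover \<open>f t\<^sub>i\<^sub>j\<close> of \<open>f\<close> has \<open>f i < f j\<close> and that no point of \<open>f\<close> lies
  strictly inside the rectangle spanned by \<open>(i, f i)\<close> and \<open>(j, f j)\<close>. Hence the window
  \<open>(g n, \<dots>, g 1)\<close>, read from right to left, increases lexicographically along every path of the
  tree. So every path is a repetition-free list over the finite set \<open>Bound k n\<close>.\<close>

section \<open>Affine permutations and transpositions\<close>

lemma affine_shift:
  assumes "f \<in> affine_perms n"
  shows "f (x + p * int n) = f x + p * int n"
proof -
  have nat_shift: "f (y + int q * int n) = f y + int q * int n" for y q
  proof (induction q)
    case (Suc q)
    have "f (y + int (Suc q) * int n) = f ((y + int q * int n) + int n)"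
      by (simp add: algebra_simps)
    also have "\<dots> = f (y + int q * int n) + int n"
      using assms unfolding affine_perms_def by blast
    finally show ?case
      using Suc by (simp add: algebra_simps)
  qed simp
  show ?thesis
  proof (cases "p \<ge> 0")
    case True
    then show ?thesis
      using nat_shift[of x "nat p"] by simp
  next
    case False
    then show ?thesis
      using nat_shift[of "x + p * int n" "nat (- p)"] by simp
  qed
qed

lemma affine_cong_shift:
  assumes "f \<in> affine_perms n" and "[x = y] (mod int n)"
  shows "f (x + c) - x = f (y + c) - y"
proof -
  obtain p where "x = y + p * int n"
    using assms(2) by (metis cong_iff_lin cong_sym mult.commute)
  then show ?thesis
    using affine_shift[OF assms(1), of "y + c" p] by (simp add: algebra_simps)
qed

lemma cong_shift_left_iff: "[x + p * m = y] (mod m) \<longleftrightarrow> [x = y] (mod m)" for x :: int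
  by (simp add: cong_def)

lemma aff_transp_shift: "aff_transp n i j (x + p * int n) = aff_transp n i j x + p * int n"
  by (simp add: aff_transp_def cong_shift_left_iff)

lemma aff_transp_aff_transp:
  assumes "\<not> [i = j] (mod int n)"
  shows "aff_transp n i j (aff_transp n i j x) = x"
proof (cases "[x = i] (mod int n)")
  case True
  then have "[x - i + j = j] (mod int n)"
    by (simp add: cong_iff_dvd_diff)
  moreover from this have "\<not> [x - i + j = i] (mod int n)"
    using assms cong_sym cong_trans by blast
  ultimately show ?thesis
    using True by (simp add: aff_transp_def)
next
  case False
  show ?thesis
  proof (cases "[x = j] (mod int n)")
    case True
    then have "[x - j + i = i] (mod int n)"
      by (simp add: cong_iff_dvd_diff)
    then show ?thesis
      using True False by (simp add: aff_transp_def)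
  qed (use False in \<open>simp add: aff_transp_def\<close>)
qed

lemma aff_transp_left [simp]: "aff_transp n i j i = j"
  by (simp add: aff_transp_def)

lemma aff_transp_right: "\<not> [i = j] (mod int n) \<Longrightarrow> aff_transp n i j j = i"
  using aff_transp_aff_transp[of i j n i] by simp

lemma affine_comp_transp:
  assumes "f \<in> affine_perms n" and "\<not> [i = j] (mod int n)"
  shows "f \<circ> aff_transp n i j \<in> affine_perms n"
proof -
  have "bij (aff_transp n i j)"
    using aff_transp_aff_transp[OF assms(2)] by (intro o_bij[of "aff_transp n i j"]) auto
  moreover have "aff_transp n i j (x + int n) = aff_transp n i j x + int n" for x
    using aff_transp_shift[of n i j x 1] by simp
  ultimately show ?thesis
    using assms(1) by (auto simp: affine_perms_def intro: bij_comp)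
qed

text \<open>By equivariance, \<open>f i < f j\<close> holds at every translate of
  \<open>(i, j)\<close>, so \<open>f\<close> rises wherever \<open>t\<close> moves right. The three
  possible displacements later limit how \<open>t\<close> can reverse a pair.\<close>

lemma affine_transp_mono:
  assumes f: "f \<in> affine_perms n" and "i < j" and lt: "f i < f j"
  defines "t \<equiv> aff_transp n i j"
  shows "x \<le> t x \<Longrightarrow> f x \<le> f (t x)" and "t x \<le> x \<Longrightarrow> f (t x) \<le> f x"
    and "t x \<in> {x, x + (j - i), x - (j - i)}"
proof -
  have up: "f (x - i + j) > f x" if "[x = i] (mod int n)"
    using affine_cong_shift[OF f that, of 0] affine_cong_shift[OF f that, of "j - i"] lt
    by (simp add: algebra_simps)
  have down: "f (x - j + i) < f x" if "[x = j] (mod int n)"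
    using affine_cong_shift[OF f that, of 0] affine_cong_shift[OF f that, of "i - j"] lt
    by (simp add: algebra_simps)
  show "x \<le> t x \<Longrightarrow> f x \<le> f (t x)" "t x \<le> x \<Longrightarrow> f (t x) \<le> f x"
    "t x \<in> {x, x + (j - i), x - (j - i)}"
    using up down \<open>i < j\<close> by (auto simp: t_def aff_transp_def split: if_splits)
qed

section \<open>Length and Bruhat covers\<close>

definition inversion_window :: "nat \<Rightarrow> (int \<Rightarrow> int) \<Rightarrow> (int \<times> int) set" where
  "inversion_window n f = {(i, j). 1 \<le> i \<and> i \<le> int n \<and> i < j \<and> f i > f j}"

lemma window_representative:
  assumes "n > 0"
  obtains y p where "x = y + p * int n" and "y \<in> {1..int n}"
proof
  \<comment> \<open>Subtracting 1 before reducing gives residues 1 to n instead of 0 to n -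
    1.\<close>
  show "x = ((x - 1) mod int n + 1) + ((x - 1) div int n) * int n"
    by (simp add: algebra_simps)
  show "(x - 1) mod int n + 1 \<in> {1..int n}"
    using assms pos_mod_bound[of "int n" "x - 1"] pos_mod_sign[of "int n" "x - 1"]
    unfolding atLeastAtMost_iff by linarith
qed

lemma window_shift_eq:
  fixes x p :: int
  assumes "x \<in> {1..int n}" and "x + p * int n \<in> {1..int n}"
  shows "p = 0"
proof (rule ccontr)
  assume "p \<noteq> 0"
  then have "p \<ge> 1 \<or> p \<le> -1" by linarith
  then have "p * int n \<ge> int n \<or> p * int n \<le> - int n"
    using mult_right_mono[of 1 p "int n"] mult_right_mono[of p "-1" "int n"] by auto
  then show False
    using assms unfolding atLeastAtMost_iff by linarith
qed

text \<open>The displacement \<open>f x - x\<close> is periodic, so bounded by some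
  \<open>C\<close>; an inversion has \<open>b \<le> f b + C < f a + C \<le> a + 2 * C\<close>.
  Finiteness matters because \<open>card\<close> of an infinite set is 0.\<close>

lemma finite_inversion_window:
  assumes f: "f \<in> affine_perms n" and "n > 0"
  shows "finite (inversion_window n f)"
proof -
  let ?A = "(\<lambda>x. \<bar>f x - x\<bar>) ` {1..int n}"
  define C where "C = Max ?A"
  have window: "\<bar>f x - x\<bar> \<le> C" if "x \<in> {1..int n}" for x
    unfolding C_def using that by (intro Max_ge) auto
  have bd: "\<bar>f x - x\<bar> \<le> C" for x
  proof -
    obtain y p where "x = y + p * int n" and "y \<in> {1..int n}"
      using window_representative[OF \<open>n > 0\<close>] .
    then show ?thesis
      using window affine_shift[OF f] by auto
  qed
  have "inversion_window n f \<subseteq> {1..int n} \<times> {1..int n + 2 * C}"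
  proof
    fix z assume "z \<in> inversion_window n f"
    then obtain a b where "z = (a, b)" "1 \<le> a" "a \<le> int n" "a < b" "f a > f b"
      by (auto simp: inversion_window_def)
    then show "z \<in> {1..int n} \<times> {1..int n + 2 * C}"
      using bd[of a] bd[of b] by auto
  qed
  then show ?thesis
    by (rule finite_subset) simp
qed

text \<open>With \<open>t = t\<^sub>i\<^sub>j\<close>, inversions \<open>(a, b)\<close> of \<open>f\<close> are injected into those of \<open>f t\<close>, modulo
  simultaneous translation by \<open>n\<close>: use \<open>(t a, t b)\<close> if \<open>t a < t b\<close>, and \<open>(a, b)\<close> itself
  otherwise. The pairs in \<open>E\<close> are inversions of \<open>f t\<close> that are not hit.\<close>

lemma aff_length_transp_ge:
  assumes f: "f \<in> affine_perms n" and n: "n > 0" and ij: "i < j" "\<not> [i = j] (mod int n)"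
    and lt: "f i < f j"
  defines "t \<equiv> aff_transp n i j"
  assumes E: "\<And>a b. (a, b) \<in> E \<Longrightarrow>
      a \<in> {1..int n} \<and> a < b \<and> t b < t a \<and> f a < f b \<and> f (t b) < f (t a)"
  shows "aff_length n f + card E \<le> aff_length n (f \<circ> t)"
proof -
  let ?I = "inversion_window n f" and ?J = "inversion_window n (f \<circ> t)"
  \<comment> \<open>\<open>\<phi>\<close> is the map described above; \<open>\<psi>\<close>
    translates its value so that the first entry lies in the window.\<close>
  define \<phi> where "\<phi> = (\<lambda>(a, b). if t a < t b then (t a, t b) else (a, b))"
  define sh where "sh = (\<lambda>p (a, b). (a + p * int n, b + p * int n))"
  define \<psi> where "\<psi> = (\<lambda>z. SOME w. fst w \<in> {1..int n} \<and> (\<exists>p. \<phi> z = sh p w))"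
  note ft = affine_comp_transp[OF f ij(2), folded t_def]
  have tt: "t (t x) = x" for x
    using aff_transp_aff_transp[OF ij(2)] by (simp add: t_def)
  have t_eq: "t x = t y \<longleftrightarrow> x = y" for x y
    by (metis tt)
  note mono = affine_transp_mono[OF f ij(1) lt, folded t_def]
  have \<psi>: "fst (\<psi> z) \<in> {1..int n} \<and> (\<exists>p. \<phi> z = sh p (\<psi> z))" for z
  proof -
    obtain a b where ab: "\<phi> z = (a, b)" by force
    obtain y p where "a = y + p * int n" and "y \<in> {1..int n}"
      using window_representative[OF n] .
    then have "\<exists>w. fst w \<in> {1..int n} \<and> (\<exists>p. \<phi> z = sh p w)"
      using ab by (intro exI[of _ "(y, b - p * int n)"]) (auto simp: sh_def)
    then show ?thesis
      unfolding \<psi>_def by (rule someI_ex)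
  qed
  have \<phi>_inv: "fst (\<phi> z) < snd (\<phi> z) \<and> f (t (snd (\<phi> z))) < f (t (fst (\<phi> z)))" if zI: "z \<in> ?I" for z
  proof -
    obtain a b where z: "z = (a, b)" "a < b" "f a > f b"
      using zI by (auto simp: inversion_window_def)
    show ?thesis
    proof (cases "t a < t b")
      case True
      then show ?thesis
        using z by (simp add: \<phi>_def tt)
    next
      case False
      then have "t b < t a"
        using t_eq[of a b] z by auto
      \<comment> \<open>If \<open>t a < a\<close>, then
        \<open>t a = a - (j - i) < b - (j - i) \<le> t b\<close>, a contradiction; the other bound
        is symmetric.\<close>
      then have "a \<le> t a" "t b \<le> b"
        using mono(3)[of a] mono(3)[of b] z(2) ij(1) by auto
      then show ?thesis
        using mono(1)[of a] mono(2)[of b] z False by (simp add: \<phi>_def)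
    qed
  qed
  have \<psi>_J: "\<psi> z \<in> ?J" if "z \<in> ?I" for z
  proof -
    obtain p where p: "\<phi> z = sh p (\<psi> z)" using \<psi> by blast
    obtain c d where cd: "\<psi> z = (c, d)" by force
    have "t (c + p * int n) = t c + p * int n" "t (d + p * int n) = t d + p * int n"
      by (simp_all add: t_def aff_transp_shift)
    then show ?thesis
      using \<phi>_inv[OF that] \<psi>[of z] p cd affine_shift[OF f]
      by (auto simp: sh_def inversion_window_def)
  qed
  have \<phi>_sh: "\<phi> (sh p z) = sh p (\<phi> z)" for p z
    by (auto simp: \<phi>_def sh_def t_def aff_transp_shift split: prod.splits)
  \<comment> \<open>\<open>t\<close> preserves the order of the image pair in the first branch only,
    so the image reveals the branch.\<close>
  have \<phi>_inj: "z = w" if "\<phi> z = \<phi> w" "fst z < snd z" "fst w < snd w" for z w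
    using that by (auto simp: \<phi>_def tt t_eq split: prod.splits if_splits)
  have sh_sh: "sh p (sh q z) = sh (p + q) z" for p q z
    by (auto simp: sh_def algebra_simps split: prod.splits)
  have sh_0: "sh 0 z = z" for z
    by (simp add: sh_def split: prod.splits)
  have inj: "inj_on \<psi> ?I"
  proof (rule inj_onI)
    fix z w assume zw: "z \<in> ?I" "w \<in> ?I" "\<psi> z = \<psi> w"
    obtain p q where "\<phi> z = sh p (\<psi> z)" "\<phi> w = sh q (\<psi> w)"
      using \<psi> by blast
    \<comment> \<open>Both images are translates of the same pair. As \<open>\<phi>\<close> commutes
      with translation, \<open>z\<close> is a translate of \<open>w\<close>, and the window forces
      it to be trivial.\<close>
    then have "\<phi> z = sh (p - q) (\<phi> w)"
      using zw(3) by (simp add: sh_sh)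
    then have "\<phi> z = \<phi> (sh (p - q) w)"
      by (simp add: \<phi>_sh)
    then have eq: "z = sh (p - q) w"
      by (rule \<phi>_inj) (use zw in \<open>auto simp: inversion_window_def sh_def\<close>)
    then have "p - q = 0"
      using zw(1,2) by (intro window_shift_eq[of "fst w" n])
        (auto simp: inversion_window_def sh_def)
    then show "z = w"
      using eq by (simp add: sh_0)
  qed
  \<comment> \<open>A preimage of \<open>(c, d)\<close> in \<open>E\<close> is, up to translation,
    \<open>(t c, t d)\<close>, which is not increasing, or \<open>(c, d)\<close>, which is no
    inversion of \<open>f\<close>.\<close>
  have disj: "\<psi> ` ?I \<inter> E = {}"
  proof -
    have hit: False if zI: "z \<in> ?I" and cd: "\<psi> z = (c, d)" and cdE: "(c, d) \<in> E" for z c d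
    proof -
      obtain p where p: "\<phi> z = sh p (c, d)" using \<psi> cd by metis
      obtain a b where ab: "z = (a, b)" "a < b" "f b < f a"
        using zI by (auto simp: inversion_window_def)
      have *: "t (c + p * int n) = t c + p * int n" "t (d + p * int n) = t d + p * int n"
        by (simp_all add: t_def aff_transp_shift)
      show False
      proof (cases "t a < t b")
        case True
        then have "t a = c + p * int n" "t b = d + p * int n"
          using p ab by (auto simp: \<phi>_def sh_def)
        then have "a = t c + p * int n" "b = t d + p * int n"
          using * tt[of a] tt[of b] by simp_all
        then show False
          using E[OF cdE] ab by auto
      next
        case False
        then have "a = c + p * int n" "b = d + p * int n"
          using p ab by (auto simp: \<phi>_def sh_def)
        then show False
          using E[OF cdE] ab affine_shift[OF f] by auto
      qed
    qed
    have "\<psi> z \<notin> E" if "z \<in> ?I" for z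
      using hit[OF that, of "fst (\<psi> z)" "snd (\<psi> z)"] by auto
    then show ?thesis by blast
  qed
  have finJ: "finite ?J" and finI: "finite ?I"
    using finite_inversion_window ft f n by auto
  have "E \<subseteq> ?J"
    using E by (auto simp: inversion_window_def)
  then have sub: "\<psi> ` ?I \<union> E \<subseteq> ?J"
    using \<psi>_J by blast
  have "card ?I + card E = card (\<psi> ` ?I \<union> E)"
    using card_image[OF inj] card_Un_disjoint[OF _ _ disj] finI finite_subset[OF sub finJ] by simp
  also have "\<dots> \<le> card ?J"
    using finJ sub by (rule card_mono)
  finally show ?thesis
    by (simp add: aff_length_def inversion_window_def)
qed

text \<open>Otherwise the preceding length bound, applied to \<open>f \<circ> t\<close> with
  \<open>E\<close> empty, shows that composing with \<open>t\<close> again, which returns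
  \<open>f\<close>, does not shorten.\<close>

lemma bruhat_cover_imp_less:
  assumes f: "f \<in> affine_perms n" and n: "n > 0" and ij: "i < j" "\<not> [i = j] (mod int n)"
    and cov: "bruhat_cover n f (f \<circ> aff_transp n i j)"
  shows "f i < f j"
proof (rule ccontr)
  assume "\<not> f i < f j"
  moreover have "f i \<noteq> f j"
    using f ij(1) by (auto simp: affine_perms_def dest!: bij_is_inj injD)
  ultimately have lt: "f j < f i" by simp
  let ?g = "f \<circ> aff_transp n i j"
  have "?g \<circ> aff_transp n i j = f"
    by (auto simp: aff_transp_aff_transp[OF ij(2)])
  then have "aff_length n ?g \<le> aff_length n f"
    using aff_length_transp_ge[OF affine_comp_transp[OF f ij(2)] n ij, of "{}"] lt
    by (simp add: aff_transp_right[OF ij(2)])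
  then show False
    using cov by (simp add: bruhat_cover_def)
qed

text \<open>A point inside the rectangle makes both \<open>(i, j)\<close> and \<open>(i, m)\<close>
  unhit inversions, so the length grows by at least 2.\<close>

lemma bruhat_cover_imp_no_between:
  assumes f: "f \<in> affine_perms n" and i: "i \<in> {1..int n}" and ij: "i < j" "\<not> [i = j] (mod int n)"
    and cov: "bruhat_cover n f (f \<circ> aff_transp n i j)"
    and m: "i < m" "m < j" "\<not> [m = i] (mod int n)"
  shows "\<not> (f i < f m \<and> f m < f j)"
proof
  assume between: "f i < f m \<and> f m < f j"
  let ?t = "aff_transp n i j"
  have n: "n > 0" using i by auto
  have lt: "f i < f j" using between by simp
  \<comment> \<open>\<open>m\<close> may be congruent to \<open>j\<close>; then it moves
    left.\<close>
  have "?t m \<le> m"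
    using m ij by (auto simp: aff_transp_def)
  then have "f (?t m) \<le> f m"
    using affine_transp_mono(2)[OF f ij(1) lt] by blast
  then have "aff_length n f + card {(i, j), (i, m)} \<le> aff_length n (f \<circ> ?t)"
    using \<open>?t m \<le> m\<close> i ij m between
    by (intro aff_length_transp_ge[OF f n ij lt]) (auto simp: aff_transp_right[OF ij(2)])
  then show False
    using cov m by (simp add: bruhat_cover_def)
qed

section \<open>The lexicographic order on windows\<close>

text \<open>\<open>m\<close> has no lower bound: for \<open>n > 0\<close>, affine permutations
  agreeing on the window are equal, so the deciding position lies in it anyway.\<close>

definition window_less :: "nat \<Rightarrow> (int \<Rightarrow> int) \<Rightarrow> (int \<Rightarrow> int) \<Rightarrow> bool" where
  "window_less n g h \<longleftrightarrow> (\<exists>m. m \<le> int n \<and> g m < h m \<and> (\<forall>x\<in>{m<..int n}. g x = h x))"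

lemma window_less_irrefl: "\<not> window_less n g g"
  by (simp add: window_less_def)

lemma window_less_trans:
  assumes "window_less n f g" and "window_less n g h"
  shows "window_less n f h"
proof -
  obtain a b where a: "a \<le> int n" "f a < g a" "\<forall>x\<in>{a<..int n}. f x = g x"
    and b: "b \<le> int n" "g b < h b" "\<forall>x\<in>{b<..int n}. g x = h x"
    using assms unfolding window_less_def by blast
  \<comment> \<open>The rightmost of the two deciding positions decides.\<close>
  then have "f (max a b) < h (max a b)"
    by (cases a b rule: linorder_cases) auto
  moreover have "\<forall>x\<in>{max a b<..int n}. f x = h x"
    using a b by auto
  ultimately show ?thesis
    using a b unfolding window_less_def by (intro exI[of _ "max a b"]) auto
qed

text \<open>The rightmost strict increase decides, so values at positions up to \<open>r\<close> do
  not matter.\<close>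

lemma window_lessI:
  assumes le: "\<And>x. x \<in> {r<..int n} \<Longrightarrow> g x \<le> h x" and s: "s \<in> {r<..int n}" "g s < h s"
  shows "window_less n g h"
proof -
  define M where "M = {x \<in> {r<..int n}. g x < h x}"
  have M: "finite M" "s \<in> M"
    unfolding M_def using s by (auto intro: finite_subset[of _ "{r<..int n}"])
  define m where "m = Max M"
  have "m \<in> M"
    unfolding m_def using M Max_in by blast
  then have m: "r < m" "m \<le> int n" "g m < h m"
    by (simp_all add: M_def)
  have "g x = h x" if x: "x \<in> {m<..int n}" for x
  proof (rule ccontr)
    assume "g x \<noteq> h x"
    then have "x \<in> M"
      using le[of x] x m by (auto simp: M_def)
    then have "x \<le> m"
      unfolding m_def using M(1) by (intro Max_ge)
    then show False
      using x by simp
  qed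
  then show ?thesis
    using m unfolding window_less_def by blast
qed

section \<open>Children and the window order\<close>

lemma window_not_cong:
  fixes x r :: int
  assumes "x \<in> {1..int n}" "r \<in> {1..int n}" "x \<noteq> r"
  shows "\<not> [x = r] (mod int n)"
proof
  assume "[x = r] (mod int n)"
  then obtain p where p: "x = r + p * int n"
    by (metis cong_iff_lin cong_sym mult.commute)
  then have "p = 0"
    using assms by (intro window_shift_eq[of r n]) auto
  then show False using p assms by simp
qed

text \<open>With \<open>g'\<close> the intermediate permutation, \<open>g \<le> g' \<le> h\<close>
  holds right of \<open>r\<close>, and the first inequality is strict at \<open>s\<close>.\<close>

lemma ls_children_window_less:
  assumes g: "g \<in> Bound k n" and h: "h \<in> ls_children k n g"
  shows "window_less n g h"
proof -
  obtain r s where max: "maximal_inversion n g r s"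
    and h: "h \<in> BPhi_minus k n (g \<circ> aff_transp n r s) r
        \<union> (BPhi_plus k n (g \<circ> aff_transp n r s) r - {g})"
    using h by (auto simp: ls_children_def)
  define g' where "g' = g \<circ> aff_transp n r s"
  have rs: "1 \<le> r" "r < s" "s \<le> int n" "g s < g r"
    and maxr: "\<And>r' s'. (r', s') \<in> window_inversions n g \<Longrightarrow> r' < r \<or> (r' = r \<and> s' \<le> s)"
    using max by (auto simp: maximal_inversion_def window_inversions_def)
  have n: "n > 0" using rs by auto
  have ga: "g \<in> affine_perms n" and gb: "\<And>x. x \<le> g x \<and> g x \<le> x + int n"
    using g by (auto simp: Bound_def)
  have g_eq: "g x = g y \<longleftrightarrow> x = y" for x y
    using ga by (auto simp: affine_perms_def dest!: bij_is_inj injD)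
  have nc: "\<not> [x = r] (mod int n)" if "x \<in> {r<..int n}" for x
    using that rs by (intro window_not_cong) auto
  have ncrs: "\<not> [r = s] (mod int n)"
    using nc[of s] rs cong_sym by auto
  have g'a: "g' \<in> affine_perms n"
    unfolding g'_def using affine_comp_transp[OF ga ncrs] .
  have g'r: "g' r = g s"
    by (simp add: g'_def)
  have g's: "g' s = g r"
    by (simp add: g'_def aff_transp_right[OF ncrs])
  have g'x: "g' x = g x" if "x \<in> {r<..int n}" "x \<noteq> s" for x
  proof -
    have "\<not> [x = s] (mod int n)"
      using that rs by (intro window_not_cong) auto
    then show ?thesis
      using nc[OF that(1)] by (simp add: g'_def aff_transp_def)
  qed
  have gg': "g x \<le> g' x" if "x \<in> {r<..int n}" for x
    using g'x[OF that] g's rs by (cases "x = s") auto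
  have g'h: "g' x \<le> h x" if x: "x \<in> {r<..int n}" for x
    using h
  proof
    assume "h \<in> BPhi_minus k n (g \<circ> aff_transp n r s) r"
    then obtain i where i: "i < r" "\<not> [i = r] (mod int n)" "h = g' \<circ> aff_transp n i r"
      "bruhat_cover n g' (g' \<circ> aff_transp n i r)"
      by (auto simp: BPhi_minus_def Phi_minus_def g'_def)
    \<comment> \<open>Not being congruent to \<open>r\<close>, \<open>x\<close> is fixed or moves
      right by \<open>r - i\<close>.\<close>
    have "x \<le> aff_transp n i r x"
      using nc[OF x] i(1) by (simp add: aff_transp_def)
    then show ?thesis
      using affine_transp_mono(1)[OF g'a i(1) bruhat_cover_imp_less[OF g'a n i(1,2,4)]] i(3)
      by simp
  next
    assume "h \<in> BPhi_plus k n (g \<circ> aff_transp n r s) r - {g}"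
    then obtain j where j: "r < j" "\<not> [r = j] (mod int n)" "h = g' \<circ> aff_transp n r j"
      "bruhat_cover n g' (g' \<circ> aff_transp n r j)" and hg: "h \<noteq> g"
      by (auto simp: BPhi_plus_def Phi_plus_def g'_def)
    have lt: "g s < g' j"
      using bruhat_cover_imp_less[OF g'a n j(1,2,4)] g'r by simp
    \<comment> \<open>The point of \<open>g'\<close> at \<open>s\<close> has height
      \<open>g r > g' r\<close> and must stay out of the rectangle of the cover.\<close>
    have le: "g' j \<le> g r" if "s < j"
      using bruhat_cover_imp_no_between[OF g'a _ j(1,2,4) rs(2) that nc[of s]] rs g'r g's by auto
    \<comment> \<open>Otherwise \<open>x\<close> would move left and lose value. Maximality of
      \<open>(r, s)\<close> and \<open>h \<noteq> g\<close> exclude \<open>j\<close> in the window;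
      boundedness excludes larger \<open>j\<close>.\<close>
    have "\<not> [x = j] (mod int n)"
    proof
      assume "[x = j] (mod int n)"
      then obtain p where p: "j = x + p * int n"
        by (metis cong_iff_lin mult.commute)
      consider "p \<le> -1" | "p = 0" | "p \<ge> 1" by linarith
      then show False
      proof cases
        case 1
        then have "p * int n \<le> - int n"
          using mult_right_mono[of p "-1" "int n"] by simp
        then show False using p x j(1) rs by auto
      next
        case 2
        then have jx: "j = x" using p by simp
        have "j \<noteq> s"
        proof
          assume "j = s"
          then have "h = g"
            using j(3) by (auto simp: g'_def aff_transp_aff_transp[OF ncrs])
          then show False using hg by simp
        qed
        then have g'j: "g' j = g j" using g'x x jx by simp
        show False
        proof (cases "j < s")
          case True
          then have "(j, s) \<in> window_inversions n g"
            using lt g'j j(1) rs by (auto simp: window_inversions_def)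
          then show False using maxr[of j s] j(1) by auto
        next
          case False
          then have "s < j" using \<open>j \<noteq> s\<close> by simp
          then have "g j < g r"
            using le g'j g_eq[of j r] j(1) by auto
          then have "(r, j) \<in> window_inversions n g"
            using rs j(1) x jx by (auto simp: window_inversions_def)
          then show False using maxr[of r j] \<open>s < j\<close> by auto
        qed
      next
        case 3
        then have pn: "p * int n \<ge> int n"
          using mult_right_mono[of 1 p "int n"] by simp
        have "s < j"
          using p x rs pn unfolding greaterThanAtMost_iff by linarith
        then have "g' j \<le> g r"
          by (rule le)
        \<comment> \<open>This gives
          \<open>g' j \<ge> x + int n > r + int n \<ge> g r\<close>.\<close>
        moreover have "g' j = g' x + p * int n"
          using affine_shift[OF g'a] p by simp
        ultimately show False
          using gg'[OF x] gb[of x] gb[of r] pn x unfolding greaterThanAtMost_iff by linarith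
      qed
    qed
    then show ?thesis
      using nc[OF x] j(3) by (simp add: aff_transp_def)
  qed
  show ?thesis
  proof (rule window_lessI)
    show "g x \<le> h x" if "x \<in> {r<..int n}" for x
      using gg'[OF that] g'h[OF that] by simp
    show "s \<in> {r<..int n}" using rs by simp
    then show "g s < h s" using g'h g's rs by fastforce
  qed
qed

section \<open>Finiteness of \<open>Bound k n\<close> and of the tree\<close>

text \<open>For \<open>n = 0\<close> the bounds force the identity. Otherwise equivariance makes the
  window values, all between 1 and 2n, determine \<open>f\<close>.\<close>

lemma finite_Bound: "finite (Bound k n)"
proof (cases "n = 0")
  case True
  have "f x = x" if "f \<in> Bound k n" for f x
  proof (rule antisym)
    show "f x \<le> x" "x \<le> f x"
      using that True by (auto simp: Bound_def)
  qed
  then have "Bound k n \<subseteq> {id}"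
    by auto
  then show ?thesis
    by (rule finite_subset) simp
next
  case False
  let ?res = "\<lambda>f. restrict f {1..int n}"
  have "?res ` Bound k n \<subseteq> {1..int n} \<rightarrow>\<^sub>E {1..2 * int n}"
  proof
    fix y assume "y \<in> ?res ` Bound k n"
    then obtain f where y: "y = ?res f" and fb: "\<And>x. x \<le> f x \<and> f x \<le> x + int n"
      by (auto simp: Bound_def)
    have "f x \<in> {1..2 * int n}" if "x \<in> {1..int n}" for x
      using fb[of x] that by auto
    then show "y \<in> {1..int n} \<rightarrow>\<^sub>E {1..2 * int n}"
      unfolding y by auto
  qed
  moreover have "inj_on ?res (Bound k n)"
  proof (rule inj_onI)
    fix f g assume "f \<in> Bound k n" "g \<in> Bound k n" and eq: "?res f = ?res g"
    then have fg: "f \<in> affine_perms n" "g \<in> affine_perms n"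
      by (auto simp: Bound_def)
    show "f = g"
    proof
      fix x
      obtain y p where "x = y + p * int n" and "y \<in> {1..int n}"
        using window_representative False by blast
      then show "f x = g x"
        using affine_shift[OF fg(1)] affine_shift[OF fg(2)] fun_cong[OF eq, of y] by simp
    qed
  qed
  ultimately show ?thesis
    by (meson finite_PiE finite_atLeastAtMost_int finite_imageD finite_subset)
qed

text \<open>Transitivity extends the increase from parent and child to all pairs on the path.
  Nonemptiness makes \<open>last p\<close> a genuine label in \<open>Bound k n\<close>.\<close>

lemma ls_tree_path:
  assumes "f \<in> Bound k n" and "p \<in> ls_tree k n f"
  shows "p \<noteq> [] \<and> set p \<subseteq> Bound k n \<and> sorted_wrt (window_less n) p"
  using assms(2)
proof induction
  case (child p h)
  have less: "window_less n (last p) h"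
    using child ls_children_window_less last_in_set by blast
  have "window_less n x h" if "x \<in> set p" for x
  proof -
    have "x = last p \<or> window_less n x (last p)"
      using that child.IH by (cases p rule: rev_cases) (auto simp: sorted_wrt_append)
    then show ?thesis
      using less window_less_trans by blast
  qed
  moreover have "h \<in> Bound k n"
    using child.hyps by (auto simp: ls_children_def BPhi_minus_def BPhi_plus_def)
  ultimately show ?case
    using child.IH by (simp add: sorted_wrt_append)
qed (use assms in simp)

theorem theorem3p7:
  fixes k n :: nat and f :: "int \<Rightarrow> int"
  assumes "0 \<le> k" and "k \<le> n" and "f \<in> Bound k n"
  shows "finite (ls_tree k n f)"
proof -
  have "distinct p" if "sorted_wrt (window_less n) p" for p
    using that by (induction p) (auto simp: window_less_irrefl)
  \<comment> \<open>Vertices are root paths, so bounding the possible lists bounds the tree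
    itself.\<close>
  then have "ls_tree k n f \<subseteq> {p. set p \<subseteq> Bound k n \<and> distinct p}"
    using ls_tree_path[OF assms(3)] by blast
  then show ?thesis
    using finite_subset_distinct[OF finite_Bound] by (rule finite_subset)
qed

end
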